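(* Let $G$ be a graph with $n$ vertices and $k$ edges. Then $\beta(G)=n-\frac{2k}{n}$ holds if and only if $G$ is the empty (edgeless) graph or $G$ is a complete multipartite graph all of whose parts have the same size.
   Context: All graphs are finite and simple. For a graph $H$, $c_i(H)$ is the number of cliques of size $i$ ($c_0=1$), $\omega(H)$ the clique number, $PC(H,x)=\sum_{i=0}^{\omega(H)}(-1)^ic_i(H)x^{\omega(H)-i}$, and $\beta(H)$ its largest real root. (It is known that always $\beta(G)\ge n-\frac{2k}{n}$.) *)

theory Defs
  imports
    Complex_Main
    "HOL-Library.Ramsey"
    "HOL-Library.Disjoint_Sets"
    "HOL-Computational_Algebra.Polynomial"
begin

definition simple_graph :: "'a set \<Rightarrow> 'a set set \<Rightarrow> bool" where
  "simple_graph V E \<longleftrightarrow> finite V \<and> E \<subseteq> [V]\<^bsup>2\<^esup>"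

definition cliques :: "'a set \<Rightarrow> 'a set set \<Rightarrow> nat \<Rightarrow> 'a set set" where
  "cliques V E i = {K \<in> [V]\<^bsup>i\<^esup>. [K]\<^bsup>2\<^esup> \<subseteq> E}"

definition clique_count :: "'a set \<Rightarrow> 'a set set \<Rightarrow> nat \<Rightarrow> nat" where
  "clique_count V E i = card (cliques V E i)"

definition clique_number :: "'a set \<Rightarrow> 'a set set \<Rightarrow> nat" where
  "clique_number V E = Max {i. cliques V E i \<noteq> {}}"

definition clique_poly :: "'a set \<Rightarrow> 'a set set \<Rightarrow> real poly" where
  "clique_poly V E =
     (\<Sum>i\<le>clique_number V E.
        monom ((-1) ^ i * real (clique_count V E i)) (clique_number V E - i))"

text \<open>The polynomial is monic, hence nonzero, so its set of real roots is finite. The maximum is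
  a meaningful value for graphs with at least one vertex, for which a real root is known to exist;
  for the graph without vertices the polynomial is the constant 1.\<close>

definition largest_clique_root :: "'a set \<Rightarrow> 'a set set \<Rightarrow> real" where
  "largest_clique_root V E = Max {x. poly (clique_poly V E) x = 0}"

definition complete_multipartite :: "'a set \<Rightarrow> 'a set set \<Rightarrow> 'a set set \<Rightarrow> bool" where
  "complete_multipartite V E P \<longleftrightarrow>
     partition_on V P \<and>
     E = {{u, v} | u v. \<exists>A\<in>P. \<exists>B\<in>P. A \<noteq> B \<and> u \<in> A \<and> v \<in> B}"

end

theory Submission
  imports Defs
begin

text \<open>Let \<open>D(W, x)\<close> be the sum of \<open>(-x)^|K|\<close> over the cliques \<open>K \<subseteq> W\<close> and let \<open>t\<close> be the least positive
  root of \<open>D(V, x)\<close>, so that \<open>\<beta> = 1/t\<close>. At \<open>t\<close> all \<open>D(W, t)\<close> are nonnegative, hence there is a random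
  clique \<open>S\<close> (the extremal measure in Shearer's theorem) with \<open>P(A \<subseteq> S) = t^|A|\<close> for every clique \<open>A\<close>.
  The variance of \<open>|S|\<close> is \<open>nt + 2kt^2 - n^2t^2\<close>, which gives \<open>\<beta> \<ge> n - 2k/n\<close>, and equality forces
  \<open>|S| = nt\<close> almost surely. Conditioning on \<open>A \<subseteq> S\<close> then shows that a clique \<open>A\<close> has exactly
  \<open>n - |A|/t\<close> common neighbours. For \<open>|A| = 1, 2\<close> this says that the neighbourhoods of two adjacent
  vertices cover \<open>V\<close>, that is, non-adjacency is transitive, and its classes have size \<open>1/t\<close>. Conversely
  \<open>D(V, x)\<close> is multiplicative over joins, so a balanced complete multipartite graph has
  \<open>D(V, x) = (1 - mx)^r\<close>.\<close>

section \<open>Cliques and the dependence polynomial\<close>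

definition clique_sets :: "'a set set \<Rightarrow> 'a set \<Rightarrow> 'a set set" where
  "clique_sets E W = {K. K \<subseteq> W \<and> [K]\<^bsup>2\<^esup> \<subseteq> E}"

text \<open>The independence polynomial of the complement of the graph induced on \<open>W\<close>,
  evaluated at \<open>- x\<close>.\<close>

definition dependence_poly :: "'a set set \<Rightarrow> 'a set \<Rightarrow> real \<Rightarrow> real" where
  "dependence_poly E W x = (\<Sum>K\<in>clique_sets E W. (- x) ^ card K)"

definition common_nbrs :: "'a set set \<Rightarrow> 'a set \<Rightarrow> 'a set \<Rightarrow> 'a set" where
  "common_nbrs E W S = {u \<in> W. \<forall>s\<in>S. {s, u} \<in> E}"

lemma clique_sets_iff:
  "K \<in> clique_sets E W \<longleftrightarrow> K \<subseteq> W \<and> (\<forall>u\<in>K. \<forall>v\<in>K. u \<noteq> v \<longrightarrow> {u, v} \<in> E)"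
  by (fastforce simp: clique_sets_def nsets_2_eq)

lemma finite_clique_sets: "finite W \<Longrightarrow> finite (clique_sets E W)"
  by (rule finite_subset[of _ "Pow W"]) (auto simp: clique_sets_def)

lemma empty_in_clique_sets [simp]: "{} \<in> clique_sets E W"
  by (simp add: clique_sets_iff)

lemma dependence_poly_at_0:
  assumes "finite W"
  shows "dependence_poly E W 0 = 1"
proof -
  \<comment> \<open>Since \<open>0 ^ 0 = 1\<close>, exactly the empty clique contributes.\<close>
  have "dependence_poly E W 0 = (\<Sum>K\<in>clique_sets E W. if K = {} then 1 else 0)"
    unfolding dependence_poly_def
  proof (rule sum.cong[OF refl])
    fix K assume "K \<in> clique_sets E W"
    hence "finite K" using assms by (auto simp: clique_sets_def intro: finite_subset)
    thus "(- 0::real) ^ card K = (if K = {} then 1 else 0)" by (simp add: power_0_left)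
  qed
  thus ?thesis using assms by (simp add: finite_clique_sets)
qed

lemma dependence_poly_empty [simp]: "dependence_poly E {} x = 1"
proof -
  have "clique_sets E {} = {{}}" by (auto simp: clique_sets_iff)
  thus ?thesis by (simp add: dependence_poly_def)
qed

lemma continuous_on_dependence_poly: "continuous_on A (dependence_poly E W)"
  unfolding dependence_poly_def by (intro continuous_intros)

text \<open>Expand the product of \<open>-1 + 1\<close> over \<open>A\<close>. This is the
  cancellation behind the inclusion-exclusion inversion in \<open>sum_weight\<close>.\<close>

lemma sum_alternating_Pow:
  assumes "finite A"
  shows "(\<Sum>B\<in>Pow A. (-1::real) ^ card B) = (if A = {} then 1 else 0)"
proof -
  have "(\<Prod>x\<in>A. (-1::real) + 1) = (\<Sum>B\<in>Pow A. (\<Prod>x\<in>B. -1) * (\<Prod>x\<in>A - B. 1))"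
    by (rule prod_add[OF assms])
  thus ?thesis using assms by (simp add: power_0_left)
qed

locale finite_graph =
  fixes V :: "'a set" and E :: "'a set set"
  assumes finite_V: "finite V" and edges: "E \<subseteq> [V]\<^bsup>2\<^esup>"
begin

abbreviation "N \<equiv> common_nbrs E V"
abbreviation "C \<equiv> clique_sets E V"
abbreviation "D \<equiv> dependence_poly E"

lemma edgeD: "{u, v} \<in> E \<Longrightarrow> u \<in> V \<and> v \<in> V \<and> u \<noteq> v"
  using subsetD[OF edges, of "{u, v}"] by (simp only: doubleton_in_nsets_2 simp_thms)

lemma finite_C: "finite C"
  using finite_V by (rule finite_clique_sets)

section \<open>Vertex deletion and the least positive root\<close>

text \<open>A clique of \<open>insert v W\<close> either avoids \<open>v\<close> or is
  \<open>v\<close> together with a clique among the neighbours of \<open>v\<close> in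
  \<open>W\<close>; in the second case \<open>v\<close> contributes a factor
  \<open>- x\<close>.\<close>

lemma dependence_poly_insert:
  assumes W: "finite W" "v \<notin> W"
  shows "D (insert v W) x = D W x - x * D {u \<in> W. {u, v} \<in> E} x"
proof -
  let ?N = "{u \<in> W. {u, v} \<in> E}"
  have split: "clique_sets E (insert v W) = clique_sets E W \<union> insert v ` clique_sets E ?N"
  proof (intro set_eqI iffI)
    fix K assume K: "K \<in> clique_sets E (insert v W)"
    show "K \<in> clique_sets E W \<union> insert v ` clique_sets E ?N"
    proof (cases "v \<in> K")
      case True
      hence "K = insert v (K - {v})" by auto
      moreover have "K - {v} \<in> clique_sets E ?N" using K True by (auto simp: clique_sets_iff)
      ultimately show ?thesis by blast
    qed (use K in \<open>auto simp: clique_sets_iff\<close>)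
  next
    fix K assume "K \<in> clique_sets E W \<union> insert v ` clique_sets E ?N"
    thus "K \<in> clique_sets E (insert v W)"
      by (auto simp: clique_sets_iff insert_commute subset_iff)
  qed
  have "D (insert v W) x
      = D W x + (\<Sum>K\<in>insert v ` clique_sets E ?N. (- x) ^ card K)"
    unfolding dependence_poly_def split
    by (rule sum.union_disjoint) (use W in \<open>auto simp: finite_clique_sets clique_sets_iff\<close>)
  also have "(\<Sum>K\<in>insert v ` clique_sets E ?N. (- x) ^ card K)
      = (\<Sum>K\<in>clique_sets E ?N. (- x) ^ card (insert v K))"
    by (rule sum.reindex[unfolded o_def], rule inj_onI)
      (use W in \<open>auto simp: clique_sets_iff insert_ident subset_iff\<close>)
  also have "\<dots> = (\<Sum>K\<in>clique_sets E ?N. (- x) * (- x) ^ card K)"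
  proof (rule sum.cong[OF refl])
    fix K assume "K \<in> clique_sets E ?N"
    hence "finite K" "v \<notin> K" using W by (auto simp: clique_sets_iff intro: finite_subset)
    thus "(- x) ^ card (insert v K) = (- x) * (- x) ^ card K" by simp
  qed
  finally show ?thesis by (simp add: dependence_poly_def sum_distrib_left sum_negf)
qed

text \<open>By the recursion, each vertex added to \<open>W\<close> subtracts \<open>x\<close> times
  a value that is assumed nonnegative.\<close>

lemma dependence_poly_antimono:
  assumes nonneg: "\<And>U. U \<subseteq> V \<Longrightarrow> 0 \<le> D U x" and "0 \<le> x" and "W \<subseteq> V"
  shows "D V x \<le> D W x"
proof -
  have "D (W \<union> F) x \<le> D W x" if "finite F" "F \<subseteq> V - W" for F
    using that
  proof (induction F rule: finite_induct)
    case (insert v F)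
    let ?N = "{u \<in> W \<union> F. {u, v} \<in> E}"
    have "D (W \<union> insert v F) x = D (W \<union> F) x - x * D ?N x"
      using insert.hyps insert.prems assms(3) finite_V dependence_poly_insert[of "W \<union> F" v x]
      by (auto intro: finite_subset)
    moreover have "0 \<le> x * D ?N x"
      using insert.prems assms by (intro mult_nonneg_nonneg nonneg) auto
    ultimately show ?case using insert by simp
  qed simp
  from this[of "V - W"] show ?thesis using finite_V assms(3) by (simp add: Un_absorb1)
qed

text \<open>Let \<open>t\<close> be the least point of the unit interval at which some
  \<open>D W\<close> with \<open>W \<subseteq> V\<close> vanishes. Up to \<open>t\<close> no
  \<open>D W\<close> changes sign, so all are nonnegative there, and antimonotonicity passes the
  zero at \<open>t\<close> on to \<open>D V\<close>.\<close>

lemma ex_least_root: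
  assumes "V \<noteq> {}"
  obtains t where "0 < t" "D V t = 0" "\<And>s. 0 < s \<Longrightarrow> s < t \<Longrightarrow> D V s \<noteq> 0"
    "\<And>W. W \<subseteq> V \<Longrightarrow> 0 \<le> D W t"
proof -
  define Z where "Z = {0..1} \<inter> (\<Union>W\<in>Pow V. {x. D W x = 0})"
  have finW: "finite W" if "W \<subseteq> V" for W using that finite_V by (rule finite_subset)
  have "closed {x. D W x = 0}" for W
    by (intro closed_Collect_eq continuous_on_dependence_poly continuous_on_const)
  hence "compact Z" unfolding Z_def using finite_V
    by (intro compact_Int_closed closed_UN) auto
  moreover have "1 \<in> Z"
  proof -
    from assms obtain v where v: "v \<in> V" by blast
    \<comment> \<open>A single vertex has \<open>D {v} x = 1 - x\<close>, so the unit interval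
      already contains a root.\<close>
    have "D {v} 1 = 0" using dependence_poly_insert[of "{}" v 1] by simp
    with v show ?thesis unfolding Z_def by force
  qed
  ultimately obtain t where t: "t \<in> Z" "\<And>s. s \<in> Z \<Longrightarrow> t \<le> s"
    using compact_attains_inf[of Z] by blast
  then obtain W0 where W0: "W0 \<subseteq> V" "D W0 t = 0" "0 \<le> t" "t \<le> 1"
    unfolding Z_def by auto
  have "t \<noteq> 0" using W0 dependence_poly_at_0[OF finW] by force
  with W0 have "0 < t" by simp
  have nz: "D W s \<noteq> 0" if "W \<subseteq> V" "0 < s" "s < t" for W s
    using that t(2)[of s] W0 unfolding Z_def by force
  have nonneg: "0 \<le> D W t" if "W \<subseteq> V" for W
  proof (rule ccontr)
    assume "\<not> 0 \<le> D W t"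
    \<comment> \<open>\<open>D W\<close> starts at 1, so a negative value at \<open>t\<close> would
      force a root strictly between 0 and \<open>t\<close>, against minimality.\<close>
    hence "\<exists>x\<ge>0. x \<le> t \<and> D W x = 0"
      using dependence_poly_at_0[OF finW[OF that]] \<open>0 < t\<close>
      by (intro IVT2' continuous_on_dependence_poly) (auto simp: less_imp_le)
    then obtain x where "0 \<le> x" "x \<le> t" "D W x = 0" by blast
    moreover have "x \<noteq> t" using \<open>\<not> 0 \<le> D W t\<close> \<open>D W x = 0\<close> by auto
    moreover have "x \<noteq> 0" using \<open>D W x = 0\<close> dependence_poly_at_0[OF finW[OF that]] by force
    ultimately show False using nz[OF that, of x] by simp
  qed
  have "D V t = 0"
    using dependence_poly_antimono[OF nonneg, of W0] W0 nonneg[of V] by simp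
  thus ?thesis using that[OF \<open>0 < t\<close>] nz[of V] nonneg by blast
qed

section \<open>The random clique and its moments\<close>

text \<open>The probability that the random clique equals \<open>S\<close>.\<close>

definition weight :: "real \<Rightarrow> 'a set \<Rightarrow> real" where
  "weight t S = t ^ card S * D (N S) t"

text \<open>The cliques \<open>T\<close> containing \<open>S\<close> are the sets
  \<open>S \<union> K\<close> with \<open>K\<close> a clique among the common neighbours of
  \<open>S\<close>. The sum is inclusion-exclusion for the event that the random clique is exactly
  \<open>S\<close>, given that it contains \<open>T\<close> with probability
  \<open>t ^ card T\<close>.\<close>

lemma weight_eq_sum:
  assumes S: "S \<in> C"
  shows "weight t S = (\<Sum>T | T \<in> C \<and> S \<subseteq> T. (-1) ^ card (T - S) * t ^ card T)"
proof -
  have "weight t S = (\<Sum>K\<in>clique_sets E (N S). t ^ card S * (- t) ^ card K)"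
    by (simp add: weight_def dependence_poly_def sum_distrib_left)
  also have "\<dots> = (\<Sum>T | T \<in> C \<and> S \<subseteq> T. (-1) ^ card (T - S) * t ^ card T)"
  proof (rule sum.reindex_bij_witness[where i = "\<lambda>T. T - S" and j = "\<lambda>K. S \<union> K"])
    fix K assume K: "K \<in> clique_sets E (N S)"
    show "S \<union> K - S = K" using K by (auto simp: clique_sets_iff common_nbrs_def dest!: edgeD)
    have "{u, v} \<in> E" if "u \<in> S" "v \<in> K" for u v
      using K that by (auto simp: clique_sets_iff common_nbrs_def)
    moreover from this have "{v, u} \<in> E" if "u \<in> S" "v \<in> K" for u v
      using that by (simp add: insert_commute)
    ultimately show "S \<union> K \<in> {T. T \<in> C \<and> S \<subseteq> T}"
      using K S by (auto simp: clique_sets_iff common_nbrs_def)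
    have "finite S" "finite K" "S \<inter> K = {}"
      using K S finite_V by (auto simp: clique_sets_iff common_nbrs_def dest!: edgeD
          intro: finite_subset)
    thus "(-1) ^ card (S \<union> K - S) * t ^ card (S \<union> K) = t ^ card S * (- t) ^ card K"
      using \<open>S \<union> K - S = K\<close>
      by (simp add: card_Un_disjoint power_add power_minus[of t])
  next
    fix T assume "T \<in> {T. T \<in> C \<and> S \<subseteq> T}"
    hence T: "T \<subseteq> V" "\<And>u v. u \<in> T \<Longrightarrow> v \<in> T \<Longrightarrow> u \<noteq> v \<Longrightarrow> {u, v} \<in> E" "S \<subseteq> T"
      by (simp_all add: clique_sets_iff)
    show "S \<union> (T - S) = T" using T(3) by blast
    show "T - S \<in> clique_sets E (N S)"
      using T unfolding clique_sets_iff common_nbrs_def by blast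
  qed
  finally show ?thesis .
qed

text \<open>Moebius inversion: after swapping the sums, the coefficient of \<open>t ^ card T\<close>
  is an alternating sum over all sets between \<open>A\<close> and \<open>T\<close>, which vanishes
  unless \<open>T = A\<close>.\<close>

lemma sum_weight:
  fixes t :: real
  assumes A: "A \<in> C"
  shows "(\<Sum>S | S \<in> C \<and> A \<subseteq> S. weight t S) = t ^ card A"
proof -
  have fin: "finite {S. S \<in> C \<and> A \<subseteq> S}" using finite_C by simp
  have "(\<Sum>S | S \<in> C \<and> A \<subseteq> S. weight t S)
      = (\<Sum>S | S \<in> C \<and> A \<subseteq> S. \<Sum>T | T \<in> C \<and> S \<subseteq> T. (-1) ^ card (T - S) * t ^ card T)"
    by (intro sum.cong refl weight_eq_sum) simp
  also have "\<dots> = (\<Sum>T\<in>C. \<Sum>S | S \<in> {S. S \<in> C \<and> A \<subseteq> S} \<and> S \<subseteq> T. (-1) ^ card (T - S) * t ^ card T)"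
    by (rule sum.swap_restrict[OF fin finite_C])
  also have "\<dots> = (\<Sum>T\<in>C. if T = A then t ^ card A else 0)"
  proof (rule sum.cong[OF refl])
    fix T assume T: "T \<in> C"
    have "finite T" using T finite_V by (auto simp: clique_sets_iff intro: finite_subset)
    show "(\<Sum>S | S \<in> {S. S \<in> C \<and> A \<subseteq> S} \<and> S \<subseteq> T. (-1) ^ card (T - S) * t ^ card T)
        = (if T = A then t ^ card A else 0)"
    proof (cases "A \<subseteq> T")
      case True
      have "(\<Sum>S | S \<in> {S. S \<in> C \<and> A \<subseteq> S} \<and> S \<subseteq> T. (-1) ^ card (T - S) * t ^ card T)
          = (\<Sum>B\<in>Pow (T - A). (-1) ^ card B * t ^ card T)"
        \<comment> \<open>Complementation in \<open>T\<close> maps the sets between \<open>A\<close>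
          and \<open>T\<close>, all of them cliques, onto the subsets of
          \<open>T - A\<close>.\<close>
        by (rule sum.reindex_bij_witness[where i = "\<lambda>B. T - B" and j = "\<lambda>S. T - S"])
          (use True T in \<open>auto simp: clique_sets_iff double_diff\<close>)
      also have "\<dots> = (if T - A = {} then 1 else 0) * t ^ card T"
        using \<open>finite T\<close> by (subst sum_alternating_Pow[symmetric]) (auto simp: sum_distrib_right)
      finally show ?thesis using True by auto
    next
      case False
      hence "{S. S \<in> {S. S \<in> C \<and> A \<subseteq> S} \<and> S \<subseteq> T} = {}" by auto
      thus ?thesis using False by (simp only: sum.empty) auto
    qed
  qed
  also have "\<dots> = t ^ card A" using A finite_C by simp
  finally show ?thesis .
qed

text \<open>Write \<open>card S\<close> as a sum of indicators over \<open>V\<close> and swap. Each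
  use trades one factor \<open>card S\<close> for a condition \<open>v \<in> S\<close>, which
  reduces moments to containment probabilities.\<close>

lemma sum_mult_card:
  fixes f :: "'a set \<Rightarrow> real"
  assumes "X \<subseteq> Pow V"
  shows "(\<Sum>S\<in>X. f S * card S) = (\<Sum>v\<in>V. \<Sum>S | S \<in> X \<and> v \<in> S. f S)"
proof -
  have "(\<Sum>S\<in>X. f S * card S) = (\<Sum>S\<in>X. \<Sum>v | v \<in> V \<and> v \<in> S. f S)"
  proof (rule sum.cong[OF refl])
    fix S assume "S \<in> X"
    hence "{v. v \<in> V \<and> v \<in> S} = S" using assms by auto
    thus "f S * card S = (\<Sum>v | v \<in> V \<and> v \<in> S. f S)" by (simp add: mult.commute)
  qed
  also have "\<dots> = (\<Sum>v\<in>V. \<Sum>S | S \<in> X \<and> v \<in> S. f S)"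
    using finite_V assms by (intro sum.swap_restrict) (auto intro: finite_subset)
  finally show ?thesis .
qed

text \<open>Sum over \<open>v\<close> the probability that \<open>insert v A\<close> is contained in
  the random clique: \<open>t ^ card A\<close> for \<open>v\<close> in \<open>A\<close>, one more
  factor \<open>t\<close> for a common neighbour, and 0 otherwise because \<open>insert v A\<close>
  is then no clique.\<close>

lemma sum_weight_card:
  fixes t :: real
  assumes A: "A \<in> C"
  shows "(\<Sum>S | S \<in> C \<and> A \<subseteq> S. weight t S * card S)
    = card A * t ^ card A + card (N A) * t ^ Suc (card A)"
proof -
  have AV: "A \<subseteq> V" "N A \<subseteq> V" "A \<inter> N A = {}"
    using A by (auto simp: clique_sets_iff common_nbrs_def dest: edgeD)
  have "finite A" using AV finite_V by (auto intro: finite_subset)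
  have "(\<Sum>S | S \<in> C \<and> A \<subseteq> S. weight t S * card S)
      = (\<Sum>v\<in>V. \<Sum>S | S \<in> {S. S \<in> C \<and> A \<subseteq> S} \<and> v \<in> S. weight t S)"
    by (rule sum_mult_card) (auto simp: clique_sets_iff)
  also have "\<dots> = (\<Sum>v\<in>V. (if v \<in> A then t ^ card A else 0) + (if v \<in> N A then t ^ Suc (card A) else 0))"
  proof (rule sum.cong[OF refl])
    fix v assume v: "v \<in> V"
    have eq: "{S. S \<in> {S. S \<in> C \<and> A \<subseteq> S} \<and> v \<in> S} = {S. S \<in> C \<and> insert v A \<subseteq> S}" by auto
    consider "v \<in> A" | "v \<in> N A" "v \<notin> A" | "v \<notin> N A" "v \<notin> A" by blast
    thus "(\<Sum>S | S \<in> {S. S \<in> C \<and> A \<subseteq> S} \<and> v \<in> S. weight t S)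
      = (if v \<in> A then t ^ card A else 0) + (if v \<in> N A then t ^ Suc (card A) else 0)"
    proof cases
      case 1
      thus ?thesis using AV sum_weight[OF A] unfolding eq by (auto simp: insert_absorb)
    next
      case 2
      have "insert v A \<in> C" using 2 A v
        by (auto simp: clique_sets_iff common_nbrs_def insert_commute)
      from sum_weight[OF this, of t] show ?thesis using 2 \<open>finite A\<close> unfolding eq by simp
    next
      case 3
      then obtain s where s: "s \<in> A" "{s, v} \<notin> E" "s \<noteq> v"
        using v by (auto simp: common_nbrs_def)
      hence "S \<notin> C" if "insert v A \<subseteq> S" for S using that unfolding clique_sets_iff by blast
      hence "{S. S \<in> C \<and> insert v A \<subseteq> S} = {}" by blast
      thus ?thesis unfolding eq using 3 by (simp only: sum.empty) auto
    qed
  qed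
  also have "\<dots> = card A * t ^ card A + card (N A) * t ^ Suc (card A)"
    using AV finite_V by (simp add: sum.distrib Int_absorb1 flip: sum.inter_restrict)
  finally show ?thesis .
qed

text \<open>Handshake lemma: \<open>u\<close> in \<open>N {v}\<close> corresponds to the edge
  \<open>{v, u}\<close> at \<open>v\<close>, and each edge has two ends.\<close>

lemma sum_degrees: "(\<Sum>v\<in>V. card (N {v})) = 2 * card E"
proof -
  have finE: "finite E" using edges finite_V
    by (meson finite_imp_finite_nsets finite_subset)
  have "card (N {v}) = card {e \<in> E. v \<in> e}" if "v \<in> V" for v
  proof (rule bij_betw_same_card[where f = "\<lambda>u. {v, u}"], rule bij_betw_imageI)
    show "inj_on (\<lambda>u. {v, u}) (N {v})" by (rule inj_onI) (auto simp: doubleton_eq_iff)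
    show "(\<lambda>u. {v, u}) ` N {v} = {e \<in> E. v \<in> e}"
    proof (intro set_eqI iffI)
      fix e assume e: "e \<in> {e \<in> E. v \<in> e}"
      then obtain a b where "e = {a, b}" using edges by (auto elim!: nsets2_E)
      with e obtain u where "e = {v, u}" "{v, u} \<in> E" by (auto simp: insert_commute)
      thus "e \<in> (\<lambda>u. {v, u}) ` N {v}" by (auto simp: common_nbrs_def dest: edgeD)
    qed (auto simp: common_nbrs_def)
  qed
  hence "(\<Sum>v\<in>V. card (N {v})) = (\<Sum>v\<in>V. card {e \<in> E. v \<in> e})" by simp
  also have "\<dots> = 2 * card E"
  proof (rule sum_multicount[OF finite_V finE], rule ballI)
    fix e assume "e \<in> E"
    hence "e \<in> [V]\<^bsup>2\<^esup>" using edges by auto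
    hence "{v \<in> V. v \<in> e} = e" "card e = 2" by (auto simp: nsets_def)
    thus "card {v \<in> V. v \<in> e} = 2" by simp
  qed
  finally show ?thesis .
qed

lemma singleton_in_C: "v \<in> V \<Longrightarrow> {v} \<in> C"
  by (simp add: clique_sets_iff)

text \<open>The mean is the case \<open>A = {}\<close> of \<open>sum_weight_card\<close>. For the
  second moment, one factor \<open>card S\<close> is expanded over the vertices, so that the case
  \<open>A = {v}\<close> applies and the degrees sum to \<open>2 * card E\<close>.\<close>

lemma weight_variance:
  fixes t :: real
  shows
  "(\<Sum>S\<in>C. weight t S * (card S - card V * t)\<^sup>2)
    = card V * t + 2 * card E * t\<^sup>2 - (card V * t)\<^sup>2"
proof -
  have N0: "N {} = V" by (simp add: common_nbrs_def)
  have m0: "(\<Sum>S\<in>C. weight t S) = 1" using sum_weight[of "{}" t] by simp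
  have m1: "(\<Sum>S\<in>C. weight t S * card S) = card V * t"
    using sum_weight_card[of "{}" t] by (simp add: N0)
  have "(\<Sum>S\<in>C. weight t S * card S * card S)
      = (\<Sum>v\<in>V. \<Sum>S | S \<in> C \<and> v \<in> S. weight t S * card S)"
    by (rule sum_mult_card) (auto simp: clique_sets_iff)
  also have "\<dots> = (\<Sum>v\<in>V. t + card (N {v}) * t\<^sup>2)"
    using sum_weight_card[OF singleton_in_C, of _ t]
    by (intro sum.cong) (simp_all add: power2_eq_square)
  also have "\<dots> = card V * t + real (\<Sum>v\<in>V. card (N {v})) * t\<^sup>2"
    by (simp add: sum.distrib sum_distrib_right)
  finally have m2: "(\<Sum>S\<in>C. weight t S * card S * card S) = card V * t + 2 * card E * t\<^sup>2"
    by (simp add: sum_degrees)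
  have "(\<Sum>S\<in>C. weight t S * (card S - card V * t)\<^sup>2)
      = (\<Sum>S\<in>C. weight t S * card S * card S - 2 * card V * t * (weight t S * card S)
          + (card V * t)\<^sup>2 * weight t S)"
    by (intro sum.cong refl) (simp add: power2_eq_square algebra_simps)
  also have "\<dots> = (\<Sum>S\<in>C. weight t S * card S * card S)
      - 2 * card V * t * (\<Sum>S\<in>C. weight t S * card S) + (card V * t)\<^sup>2 * (\<Sum>S\<in>C. weight t S)"
    by (simp add: sum.distrib sum_subtractf sum_distrib_left)
  also have "\<dots> = card V * t + 2 * card E * t\<^sup>2 - (card V * t)\<^sup>2"
    unfolding m0 m1 m2 by (simp add: power2_eq_square algebra_simps)
  finally show ?thesis .
qed

lemma weight_nonneg:
  fixes t :: real
  assumes "0 < t" "\<And>W. W \<subseteq> V \<Longrightarrow> 0 \<le> D W t"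
  shows "0 \<le> weight t S"
  unfolding weight_def using assms by (auto intro!: mult_nonneg_nonneg simp: common_nbrs_def)

section \<open>The clique polynomial and its largest root\<close>

text \<open>Grouping cliques by size shows that the clique polynomial is the reversal of
  \<open>D V\<close>, so nonzero roots of one are reciprocals of roots of the other.\<close>

lemma poly_clique_poly:
  assumes "x \<noteq> 0"
  shows "poly (clique_poly V E) x = x ^ clique_number V E * D V (1 / x)"
proof -
  let ?w = "clique_number V E"
  have sub: "{i. cliques V E i \<noteq> {}} \<subseteq> {..card V}"
    using finite_V by (auto simp: cliques_def nsets_def card_mono)
  hence fin: "finite {i. cliques V E i \<noteq> {}}" by (rule finite_subset) simp
  have le: "card K \<le> ?w" if "K \<in> C" for K
    unfolding clique_number_def
  proof (rule Max_ge[OF fin])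
    have "finite K" using that finite_V by (auto simp: clique_sets_iff intro: finite_subset)
    hence "K \<in> cliques V E (card K)" using that by (auto simp: cliques_def clique_sets_def nsets_def)
    thus "card K \<in> {i. cliques V E i \<noteq> {}}" by blast
  qed
  have cl: "cliques V E i = {K \<in> C. card K = i}" for i
    using finite_V by (auto simp: cliques_def clique_sets_def nsets_def intro: finite_subset)
  have "poly (clique_poly V E) x
      = (\<Sum>i\<le>?w. (-1) ^ i * real (card {K \<in> C. card K = i}) * x ^ (?w - i))"
    by (simp add: clique_poly_def poly_sum poly_monom clique_count_def cl)
  also have "\<dots> = (\<Sum>i\<le>?w. \<Sum>K | K \<in> C \<and> card K = i. x ^ ?w * (- (1 / x)) ^ card K)"
  proof (rule sum.cong[OF refl])
    fix i assume "i \<in> {..?w}"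
    hence "x ^ ?w = x ^ (?w - i) * x ^ i" by (simp flip: power_add)
    hence "x ^ ?w * (- (1 / x)) ^ i = (-1) ^ i * x ^ (?w - i)"
      using assms by (simp add: power_minus[of "1 / x"] power_one_over)
    thus "(-1) ^ i * real (card {K \<in> C. card K = i}) * x ^ (?w - i)
        = (\<Sum>K | K \<in> C \<and> card K = i. x ^ ?w * (- (1 / x)) ^ card K)"
      by simp
  qed
  also have "\<dots> = (\<Sum>K\<in>C. x ^ ?w * (- (1 / x)) ^ card K)"
    by (rule sum.group) (use le finite_C in auto)
  finally show ?thesis by (simp add: dependence_poly_def sum_distrib_left)
qed

text \<open>The constant coefficient is, up to sign, the number of maximum cliques. Hence the
  polynomial is nonzero and 0 is not among its roots.\<close>

lemma clique_poly_at_0: "poly (clique_poly V E) 0 \<noteq> 0"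
proof -
  let ?w = "clique_number V E" and ?I = "{i. cliques V E i \<noteq> {}}"
  have sub: "?I \<subseteq> {..card V}"
    using finite_V by (auto simp: cliques_def nsets_def card_mono)
  hence fin: "finite ?I" by (rule finite_subset) simp
  have "0 \<in> ?I" by (simp add: cliques_def nsets_2_eq)
  hence "?w \<in> ?I" unfolding clique_number_def using Max_in[OF fin] by blast
  moreover have "finite (cliques V E ?w)"
    using finite_V by (simp add: cliques_def finite_imp_finite_nsets)
  ultimately have nz: "clique_count V E ?w \<noteq> 0" by (simp add: clique_count_def)
  have "poly (clique_poly V E) 0
      = (\<Sum>i\<le>?w. if i = ?w then (-1) ^ i * real (clique_count V E i) else 0)"
    unfolding clique_poly_def poly_sum poly_monom
    by (intro sum.cong) (auto simp: power_0_left)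
  thus ?thesis using nz by simp
qed

text \<open>Positive roots are the reciprocals of positive roots of \<open>D V\<close>, so the least
  of the latter gives the largest of the former; negative roots do not matter for the
  maximum.\<close>

lemma largest_clique_root_eq:
  fixes t :: real
  assumes "0 < t" "D V t = 0" "\<And>s. 0 < s \<Longrightarrow> s < t \<Longrightarrow> D V s \<noteq> 0"
  shows "largest_clique_root V E = 1 / t"
  unfolding largest_clique_root_def
proof (rule Max_eqI)
  have "clique_poly V E \<noteq> 0" using clique_poly_at_0 by auto
  thus "finite {x. poly (clique_poly V E) x = 0}" by (rule poly_roots_finite)
  show "1 / t \<in> {x. poly (clique_poly V E) x = 0}"
    using assms poly_clique_poly[of "1 / t"] by simp
next
  fix x assume "x \<in> {x. poly (clique_poly V E) x = 0}"
  hence x: "poly (clique_poly V E) x = 0" by simp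
  hence "x \<noteq> 0" using clique_poly_at_0 by auto
  show "x \<le> 1 / t"
  proof (cases "0 < x")
    case True
    have "D V (1 / x) = 0" using poly_clique_poly[OF \<open>x \<noteq> 0\<close>] x \<open>x \<noteq> 0\<close> by simp
    hence "\<not> 1 / x < t" using assms(3)[of "1 / x"] True by auto
    thus ?thesis using True assms(1) by (simp add: field_simps)
  next
    case False
    thus ?thesis using assms(1) by (smt (verit) divide_nonneg_pos)
  qed
qed

section \<open>Equality forces a balanced complete multipartite graph\<close>

lemma common_nbrs_card_of_equality:
  fixes t :: real
  assumes "0 < t" and nonneg: "\<And>W. W \<subseteq> V \<Longrightarrow> 0 \<le> D W t"
    and "V \<noteq> {}" and eq: "1 / t = card V - 2 * card E / card V" and A: "A \<in> C"
  shows "card A + card (N A) * t = card V * t"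
proof -
  let ?n = "real (card V)"
  have "?n > 0" using assms(3) finite_V by (simp add: card_gt_0_iff)
  \<comment> \<open>With \<open>1 / t\<close> as the largest root, the variance is a positive
    multiple of the gap in the inequality.\<close>
  have "?n * t + 2 * card E * t\<^sup>2 - (?n * t)\<^sup>2 = ?n * t\<^sup>2 * (1 / t - (?n - 2 * card E / ?n))"
    using \<open>?n > 0\<close> \<open>0 < t\<close> by (simp add: field_simps power2_eq_square)
  also have "\<dots> = 0" using eq by simp
  finally have "(\<Sum>S\<in>C. weight t S * (card S - ?n * t)\<^sup>2) = 0"
    by (simp add: weight_variance)
  hence zero: "weight t S * (card S - ?n * t)\<^sup>2 = 0" if "S \<in> C" for S
    using that weight_nonneg[OF \<open>0 < t\<close> nonneg] finite_C
    by (subst (asm) sum_nonneg_eq_0_iff) auto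
  have "card A * t ^ card A + card (N A) * t ^ Suc (card A)
      = (\<Sum>S | S \<in> C \<and> A \<subseteq> S. weight t S * card S)"
    by (rule sum_weight_card[OF A, symmetric])
  also have "\<dots> = (\<Sum>S | S \<in> C \<and> A \<subseteq> S. weight t S * (?n * t))"
    \<comment> \<open>For each \<open>S\<close> either the weight is 0 or
      \<open>card S = ?n * t\<close>, so the constant may replace \<open>card S\<close>.\<close>
    by (rule sum.cong[OF refl]) (use zero in force)
  also have "\<dots> = t ^ card A * (?n * t)"
    by (simp add: sum_weight[OF A] flip: sum_distrib_right)
  finally have "t ^ card A * (card A + card (N A) * t) = t ^ card A * (?n * t)"
    by (simp add: algebra_simps)
  thus ?thesis using \<open>0 < t\<close> by simp
qed

text \<open>The hypothesis is used for single vertices, which fixes the degrees, and for edges,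
  which fixes the number of common neighbours of adjacent vertices. The parts are the classes of
  non-adjacency.\<close>

lemma complete_multipartite_of_common_nbrs:
  fixes t :: real
  assumes "0 < t" and cn: "\<And>A. A \<in> C \<Longrightarrow> card A + card (N A) * t = card V * t"
  shows "\<exists>P. complete_multipartite V E P \<and> (\<exists>m. \<forall>A\<in>P. card A = m)"
proof -
  have N1: "N {v} \<subseteq> V" for v by (auto simp: common_nbrs_def)
  have finN: "finite (N {v})" for v using N1 finite_V by (rule finite_subset)
  have deg: "1 + card (N {v}) * t = card V * t" if "v \<in> V" for v
    using cn[OF singleton_in_C[OF that]] by simp
  have cover: "w \<in> N {u} \<union> N {v}" if "{u, v} \<in> E" "w \<in> V" for u v w
  proof -
    have uv: "u \<in> V" "v \<in> V" "u \<noteq> v" using edgeD[OF that(1)] by auto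
    have "{u, v} \<in> C" using uv that(1) by (auto simp: clique_sets_iff insert_commute)
    moreover have "N {u, v} = N {u} \<inter> N {v}" by (auto simp: common_nbrs_def)
    ultimately have "2 + card (N {u} \<inter> N {v}) * t = card V * t"
      using cn[of "{u, v}"] uv by simp
    hence "(real (card (N {u})) + real (card (N {v}))) * t
        = (real (card V) + real (card (N {u} \<inter> N {v}))) * t"
      using deg[OF uv(1)] deg[OF uv(2)] by (simp add: algebra_simps)
    hence "card (N {u}) + card (N {v}) = card V + card (N {u} \<inter> N {v})"
      using \<open>0 < t\<close> by (simp flip: of_nat_add)
    \<comment> \<open>With \<open>n = card V\<close>, the sizes are \<open>n - 1/t\<close> for each
      neighbourhood and \<open>n - 2/t\<close> for the intersection, so the union has
      \<open>n\<close> elements.\<close>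
    hence "card (N {u} \<union> N {v}) = card V"
      using card_Un_Int[OF finN finN, of u v] by simp
    hence "N {u} \<union> N {v} = V" using finite_V N1 by (intro card_subset_eq) auto
    thus ?thesis using that by simp
  qed
  define R where "R = {(u, v). u \<in> V \<and> v \<in> V \<and> {u, v} \<notin> E}"
  have "equiv V R"
  proof (rule equivI)
    show "R \<subseteq> V \<times> V" by (auto simp: R_def)
    have "{v, v} \<notin> E" for v using edgeD by blast
    thus "refl_on V R" by (simp add: R_def refl_on_def)
    show "sym R" by (auto simp: R_def sym_def insert_commute)
    show "trans R"
    proof (rule transI)
      fix u v w assume *: "(u, v) \<in> R" "(v, w) \<in> R"
      \<comment> \<open>A vertex adjacent to neither \<open>u\<close> nor \<open>w\<close>
        contradicts \<open>cover\<close> if \<open>{u, w}\<close> is an edge.\<close>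
      hence "v \<notin> N {u} \<union> N {w}" by (simp add: R_def common_nbrs_def insert_commute)
      hence "{u, w} \<notin> E" using cover[of u w v] * by (auto simp: R_def)
      thus "(u, w) \<in> R" using * by (simp add: R_def)
    qed
  qed
  let ?P = "V // R"
  have class_eq: "R `` {v} = V - N {v}" if "v \<in> V" for v
    using that by (auto simp: R_def common_nbrs_def)
  have part: "partition_on V ?P" by (rule partition_on_quotient[OF \<open>equiv V R\<close>])
  have "E = {{u, v} | u v. \<exists>A\<in>?P. \<exists>B\<in>?P. A \<noteq> B \<and> u \<in> A \<and> v \<in> B}"
  proof (intro set_eqI iffI)
    fix e assume "e \<in> E"
    then obtain u v where e: "e = {u, v}" using edges by (auto elim!: nsets2_E)
    with \<open>e \<in> E\<close> have uv: "{u, v} \<in> E" "u \<in> V" "v \<in> V" by (auto dest: edgeD)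
    hence "(u, v) \<notin> R" by (simp add: R_def)
    hence "R `` {u} \<noteq> R `` {v}" using uv eq_equiv_class[OF _ \<open>equiv V R\<close>] by blast
    moreover have "R `` {u} \<in> ?P" "R `` {v} \<in> ?P" using uv by (auto intro: quotientI)
    moreover have "u \<in> R `` {u}" "v \<in> R `` {v}" using uv equiv_class_self[OF \<open>equiv V R\<close>] by auto
    ultimately have "\<exists>A\<in>?P. \<exists>B\<in>?P. A \<noteq> B \<and> u \<in> A \<and> v \<in> B"
      by (intro bexI[of _ "R `` {u}"] bexI[of _ "R `` {v}"]) simp_all
    with e show "e \<in> {{u, v} | u v. \<exists>A\<in>?P. \<exists>B\<in>?P. A \<noteq> B \<and> u \<in> A \<and> v \<in> B}"
      by (intro CollectI exI conjI)
  next
    fix e assume "e \<in> {{u, v} | u v. \<exists>A\<in>?P. \<exists>B\<in>?P. A \<noteq> B \<and> u \<in> A \<and> v \<in> B}"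
    then obtain u v A B where *: "e = {u, v}" "A \<in> ?P" "B \<in> ?P" "A \<noteq> B" "u \<in> A" "v \<in> B" by blast
    hence "(u, v) \<notin> R" using quotient_eqI[OF \<open>equiv V R\<close>] by blast
    moreover have "u \<in> V" "v \<in> V" using * partition_onD1[OF part] by auto
    ultimately show "e \<in> E" using * by (simp add: R_def)
  qed
  with part have "complete_multipartite V E ?P" by (simp add: complete_multipartite_def)
  \<comment> \<open>Every class has size exactly \<open>1 / t\<close>; the floor only names this
    value as a natural number.\<close>
  moreover have "\<forall>A\<in>?P. card A = nat \<lfloor>1 / t\<rfloor>"
  proof
    fix A assume "A \<in> ?P"
    then obtain v where v: "v \<in> V" "A = R `` {v}" by (auto elim: quotientE)
    have "card (N {v}) \<le> card V" using N1 finite_V by (simp add: card_mono)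
    hence "real (card A) = real (card V) - real (card (N {v}))"
      using v class_eq finN N1 by (simp add: card_Diff_subset of_nat_diff)
    also have "\<dots> = 1 / t" using deg[OF v(1)] \<open>0 < t\<close> by (simp add: field_simps)
    finally show "card A = nat \<lfloor>1 / t\<rfloor>" by (metis floor_of_nat nat_int)
  qed
  ultimately show ?thesis by blast
qed

section \<open>Joins and balanced complete multipartite graphs\<close>

text \<open>When the vertices of \<open>A\<close> are added one by one, the earlier neighbours of
  each are exactly \<open>W\<close>, so each subtracts the same term
  \<open>x * D W x\<close>.\<close>

lemma dependence_poly_join_independent:
  fixes x :: real
  assumes "finite W" "finite A" "W \<inter> A = {}"
    and "\<And>u v. u \<in> A \<Longrightarrow> v \<in> A \<Longrightarrow> {u, v} \<notin> E"
    and "\<And>u v. u \<in> W \<Longrightarrow> v \<in> A \<Longrightarrow> {u, v} \<in> E"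
  shows "D (W \<union> A) x = (1 - card A * x) * D W x"
  using assms(2-)
proof (induction A rule: finite_induct)
  case (insert v A)
  have "{u \<in> W \<union> A. {u, v} \<in> E} = W" using insert.prems by blast
  thus ?case
    using insert dependence_poly_insert[of "W \<union> A" v x] assms(1) by (simp add: algebra_simps)
qed simp

lemma complete_multipartite_edge_iff:
  assumes P: "complete_multipartite V E P" and "A \<in> P" "B \<in> P" "u \<in> A" "v \<in> B"
  shows "{u, v} \<in> E \<longleftrightarrow> A \<noteq> B"
proof -
  have "disjoint P" using P partition_onD2[of V P] by (simp only: complete_multipartite_def)
  hence uniq: "X = Y" if "X \<in> P" "Y \<in> P" "w \<in> X" "w \<in> Y" for X Y w
    using that by (auto simp: disjoint_def)
  have E: "E = {{u, v} | u v. \<exists>A\<in>P. \<exists>B\<in>P. A \<noteq> B \<and> u \<in> A \<and> v \<in> B}"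
    using P by (simp add: complete_multipartite_def)
  show ?thesis
  proof
    assume "{u, v} \<in> E"
    then obtain a b X Y where "{u, v} = {a, b}" "X \<in> P" "Y \<in> P" "X \<noteq> Y" "a \<in> X" "b \<in> Y"
      unfolding E by blast
    thus "A \<noteq> B" using assms(2-) uniq by (metis doubleton_eq_iff)
  next
    assume "A \<noteq> B"
    thus "{u, v} \<in> E" unfolding E using assms(2-) by blast
  qed
qed

lemma dependence_poly_complete_multipartite:
  fixes x :: real
  assumes P: "complete_multipartite V E P"
  shows "D V x = (\<Prod>A\<in>P. 1 - card A * x)"
proof -
  have part: "partition_on V P" using P by (simp add: complete_multipartite_def)
  have "finite P" using finite_elements[OF finite_V part] .
  have "D (\<Union>Q) x = (\<Prod>A\<in>Q. 1 - card A * x)" if "finite Q" "Q \<subseteq> P" for Q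
    using that
  proof (induction Q rule: finite_induct)
    case (insert A Q)
    have sub: "\<Union>Q \<subseteq> V" "A \<subseteq> V" using insert.prems partition_onD1[OF part] by auto
    have "D (\<Union>Q \<union> A) x = (1 - card A * x) * D (\<Union>Q) x"
    proof (rule dependence_poly_join_independent)
      show "finite (\<Union>Q)" "finite A" using sub finite_V by (auto intro: finite_subset)
      show "\<Union>Q \<inter> A = {}"
        using insert.hyps insert.prems partition_onD2[OF part] by (fastforce simp: disjoint_def)
      show "{u, v} \<notin> E" if "u \<in> A" "v \<in> A" for u v
        using complete_multipartite_edge_iff[OF P, of A A u v] insert.prems that by simp
      show "{u, v} \<in> E" if uv: "u \<in> \<Union>Q" "v \<in> A" for u v
      proof -
        from uv obtain B where "B \<in> Q" "u \<in> B" by blast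
        thus ?thesis
          using complete_multipartite_edge_iff[OF P, of B A u v] insert uv by auto
      qed
    qed
    thus ?case using insert by (simp add: Un_commute)
  qed simp
  from this[OF \<open>finite P\<close>] show ?thesis using partition_onD1[OF part] by simp
qed

text \<open>Here \<open>D V x\<close> is a power of \<open>1 - m * x\<close>, so the largest root is
  \<open>m\<close>. All degrees are \<open>card V - m\<close>, and the handshake lemma gives the
  same value for the right-hand side.\<close>

lemma largest_clique_root_balanced:
  assumes "V \<noteq> {}" and P: "complete_multipartite V E P" and m: "\<And>A. A \<in> P \<Longrightarrow> card A = m"
  shows "largest_clique_root V E = card V - 2 * card E / card V"
proof -
  have part: "partition_on V P" using P by (simp add: complete_multipartite_def)
  have finP: "finite P" using finite_elements[OF finite_V part] .
  have "P \<noteq> {}" using part assms(1) by (auto simp: partition_on_def)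
  then obtain A where "A \<in> P" by blast
  hence "A \<noteq> {}" "finite A"
    using partition_onD3[OF part] partition_onD1[OF part] finite_V by (auto intro: finite_subset)
  hence "0 < m" using m[OF \<open>A \<in> P\<close>] by (auto simp: card_gt_0_iff)
  have D: "D V x = (1 - m * x) ^ card P" for x :: real
    using dependence_poly_complete_multipartite[OF P] m by simp
  have "largest_clique_root V E = 1 / (1 / m)"
  proof (rule largest_clique_root_eq)
    show "D V (1 / m) = 0" using D \<open>0 < m\<close> finP \<open>P \<noteq> {}\<close> by (simp add: card_gt_0_iff)
    show "D V s \<noteq> 0" if "s < 1 / m" for s using D that \<open>0 < m\<close> by (auto simp: field_simps)
  qed (use \<open>0 < m\<close> in simp)
  moreover have "card (N {v}) = card V - m" if "v \<in> V" for v
  proof -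
    obtain B where B: "B \<in> P" "v \<in> B" using \<open>v \<in> V\<close> partition_onD1[OF part] by blast
    have "N {v} = V - B"
    proof (intro set_eqI iffI)
      fix u assume "u \<in> N {v}"
      thus "u \<in> V - B" using complete_multipartite_edge_iff[OF P B(1) B(1) B(2)]
        by (auto simp: common_nbrs_def)
    next
      fix u assume u: "u \<in> V - B"
      then obtain A where "A \<in> P" "u \<in> A" using partition_onD1[OF part] by blast
      thus "u \<in> N {v}" using complete_multipartite_edge_iff[OF P B(1) _ B(2)] u
        by (auto simp: common_nbrs_def)
    qed
    moreover have "B \<subseteq> V" using B partition_onD1[OF part] by blast
    ultimately show ?thesis using m[OF B(1)] finite_V by (simp add: card_Diff_subset finite_subset)
  qed
  hence "2 * card E = card V * (card V - m)" using sum_degrees by simp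
  \<comment> \<open>This lets the truncated subtraction \<open>card V - m\<close> pass to the
    reals.\<close>
  moreover have "m \<le> card V"
    using m[OF \<open>A \<in> P\<close>] \<open>A \<in> P\<close> partition_onD1[OF part] finite_V by (auto intro: card_mono)
  ultimately have "2 * real (card E) = card V * (real (card V) - m)"
    by (metis of_nat_diff of_nat_mult of_nat_numeral)
  moreover have "0 < card V" using assms(1) finite_V by (simp add: card_gt_0_iff)
  ultimately show ?thesis using \<open>largest_clique_root V E = 1 / (1 / m)\<close> by simp
qed

end

theorem theorem7p1:
  fixes V :: "'a set" and E :: "'a set set" and n k :: nat
  assumes "simple_graph V E" and "V \<noteq> {}"
    and "n = card V" and "k = card E"
  shows "largest_clique_root V E = real n - 2 * real k / real n \<longleftrightarrow>
    E = {} \<or>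
    (\<exists>P. complete_multipartite V E P \<and> (\<exists>m. \<forall>A\<in>P. card A = m))"
proof -
  interpret finite_graph V E
    using assms(1) by unfold_locales (auto simp: simple_graph_def)
  obtain t where t: "0 < t" "D V t = 0" "\<And>s. 0 < s \<Longrightarrow> s < t \<Longrightarrow> D V s \<noteq> 0"
    and nonneg: "\<And>W. W \<subseteq> V \<Longrightarrow> 0 \<le> D W t"
    using ex_least_root[OF assms(2)] by blast
  show ?thesis
  proof
    assume "largest_clique_root V E = real n - 2 * real k / real n"
    hence "1 / t = card V - 2 * card E / card V"
      using largest_clique_root_eq[OF t] assms(3,4) by simp
    hence "card A + card (N A) * t = card V * t" if "A \<in> C" for A
      using common_nbrs_card_of_equality[OF t(1) nonneg assms(2) _ that] by blast
    from complete_multipartite_of_common_nbrs[OF t(1) this]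
    show "E = {} \<or> (\<exists>P. complete_multipartite V E P \<and> (\<exists>m. \<forall>A\<in>P. card A = m))" ..
  next
    assume "E = {} \<or> (\<exists>P. complete_multipartite V E P \<and> (\<exists>m. \<forall>A\<in>P. card A = m))"
    hence "\<exists>P. complete_multipartite V E P \<and> (\<exists>m. \<forall>A\<in>P. card A = m)"
    proof
      assume "E = {}"
      \<comment> \<open>An edgeless graph is complete multipartite with a single part, which is
        nonempty since \<open>V\<close> is.\<close>
      hence "complete_multipartite V E {V}"
        using partition_on_space[OF assms(2)] by (simp add: complete_multipartite_def)
      thus ?thesis by (intro exI[of _ "{V}"]) simp
    qed
    then obtain P m where "complete_multipartite V E P" "\<And>A. A \<in> P \<Longrightarrow> card A = m"
      by blast
    thus "largest_clique_root V E = real n - 2 * real k / real n"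
      using largest_clique_root_balanced[OF assms(2)] assms(3,4) by simp
  qed
qed

end
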